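(* Let $\mathcal G$ be a connected unweighted graph on $n\ge2$ nodes with $m$ edges and diameter $\mathrm{diam}(\mathcal G)$. Then $$\frac{(n-1)^2}{4m}\ \le\ \rho_{ss}(L_{\mathcal G};M_n)\ \le\ \frac1{2n}\left[n-1+\left[\binom n2-m\right]\mathrm{diam}(\mathcal G)\right].$$ If $\mathcal G=\mathcal K_n$ (the complete graph), then the lower and upper bounds coincide and $\rho_{ss}(L_{\mathcal K_n};M_n)=\frac{n-1}{2n}$. Moreover, the star graph $\mathcal S_n$ achieves the upper bound.
   Context: Graphs are finite, simple, undirected. The diameter is the largest distance between pairs of nodes. $L_{\mathcal G}$ is the graph Laplacian (degree matrix minus adjacency matrix) with eigenvalues $0=\lambda_1<\lambda_2\le\dots\le\lambda_n$, $M_n=I_n-\frac1nJ_n$ is the centering matrix, and $\rho_{ss}(L_{\mathcal G};M_n)=\frac12\sum_{i=2}^n\lambda_i^{-1}$ is the performance measure of the first-order consensus network $\dot x=-L_{\mathcal G}x+\xi$, $y=M_nx$. *)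

theory Defs
  imports Complex_Main "HOL-Library.Multiset" "Jordan_Normal_Form.Char_Poly"
begin

text \<open>A graph is a finite node set \<open>V\<close> together with a set \<open>E\<close> of two-element subsets of \<open>V\<close>.\<close>

definition simple_graph :: "'a set \<Rightarrow> 'a set set \<Rightarrow> bool" where
  "simple_graph V E \<longleftrightarrow> finite V \<and> (\<forall>e\<in>E. e \<subseteq> V \<and> card e = 2)"

definition adj_rel :: "'a set set \<Rightarrow> 'a rel" where
  "adj_rel E = {(u, v). {u, v} \<in> E}"

definition connected_graph :: "'a set \<Rightarrow> 'a set set \<Rightarrow> bool" where
  "connected_graph V E \<longleftrightarrow> V \<noteq> {} \<and> (\<forall>u\<in>V. \<forall>v\<in>V. (u, v) \<in> (adj_rel E)\<^sup>*)"

text \<open>The distance is the least length of a walk. It is meaningful only for nodes that are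
  joined by a walk, so the diameter below is used for connected graphs only.\<close>

definition graph_dist :: "'a set set \<Rightarrow> 'a \<Rightarrow> 'a \<Rightarrow> nat" where
  "graph_dist E u v = (LEAST k. (u, v) \<in> adj_rel E ^^ k)"

definition graph_diam :: "'a set \<Rightarrow> 'a set set \<Rightarrow> nat" where
  "graph_diam V E = Max {graph_dist E u v |u v. u \<in> V \<and> v \<in> V}"

definition complete_edges :: "'a set \<Rightarrow> 'a set set" where
  "complete_edges V = {e. e \<subseteq> V \<and> card e = 2}"

definition star_edges :: "'a set \<Rightarrow> 'a \<Rightarrow> 'a set set" where
  "star_edges V c = {{c, v} |v. v \<in> V - {c}}"

definition degree_of :: "'a set set \<Rightarrow> 'a \<Rightarrow> nat" where
  "degree_of E v = card {e \<in> E. v \<in> e}"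

text \<open>Matrices are taken with respect to an enumeration \<open>vs\<close> of the nodes (a list without
  repetitions): row and column \<open>i\<close> belong to the node \<open>vs ! i\<close>.\<close>

definition degree_matrix :: "'a list \<Rightarrow> 'a set set \<Rightarrow> real mat" where
  "degree_matrix vs E = mat (length vs) (length vs)
     (\<lambda>(i, j). if i = j then real (degree_of E (vs ! i)) else 0)"

definition adjacency_matrix :: "'a list \<Rightarrow> 'a set set \<Rightarrow> real mat" where
  "adjacency_matrix vs E = mat (length vs) (length vs)
     (\<lambda>(i, j). if {vs ! i, vs ! j} \<in> E then 1 else 0)"

definition laplacian :: "'a list \<Rightarrow> 'a set set \<Rightarrow> real mat" where
  "laplacian vs E = degree_matrix vs E - adjacency_matrix vs E"

text \<open>The \<open>i\<close>-th smallest eigenvalue, \<open>i = 1, \<dots>, n\<close>, counted with algebraic multiplicity. All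
  roots of the characteristic polynomial of a real symmetric \<open>n \<times> n\<close> matrix are real, so for
  such a matrix the sorted list of the real roots has length \<open>n\<close>.\<close>

definition nth_eigenvalue :: "real mat \<Rightarrow> nat \<Rightarrow> real" where
  "nth_eigenvalue A i = sorted_list_of_multiset (proots (char_poly A)) ! (i - 1)"

text \<open>Performance measure of the first-order consensus network \<open>x' = - L x + \<xi>\<close>, \<open>y = M\<^sub>n x\<close>
  with the centering matrix \<open>M\<^sub>n\<close> as output matrix, for a Laplacian \<open>L\<close> of a connected graph.\<close>

definition rho_ss :: "real mat \<Rightarrow> real" where
  "rho_ss L = 1 / 2 * (\<Sum>i = 2..dim_row L. inverse (nth_eigenvalue L i))"

end

theory Submission
  imports Defs "Jordan_Normal_Form.Schur_Decomposition"
begin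

text \<open>Write \<open>r\<^sub>u\<^sub>v\<close> for the effective resistance between \<open>u\<close> and \<open>v\<close>. Summed over all pairs of nodes it
  measures the trace of the inverse Laplacian: \<open>\<Sum>\<^sub>i\<^sub>\<ge>\<^sub>2 1/\<lambda>\<^sub>i = (1/n) \<Sum> r\<^sub>u\<^sub>v\<close>, the sum ranging over the
  unordered pairs, so the performance measure is \<open>1/(2n)\<close> times the total resistance.

  For the upper bound, the total resistance is split into adjacent and nonadjacent pairs. By Foster's
  theorem (\<open>sum_resistance_edges\<close>) the adjacent pairs contribute exactly \<open>n - 1\<close>. Each of the
  remaining \<open>(n choose 2) - m\<close> pairs contributes at most its distance (\<open>resistance_le_dist\<close>),
  hence at most the diameter. In a star the nonadjacent pairs are the pairs of leaves; current between
  two leaves flows through two edges in series, so the resistance is \<open>2\<close>, which is also the distance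
  and the diameter, and the bound is attained. For the lower bound, the trace of the Laplacian is the
  sum \<open>2m\<close> of the degrees, and Cauchy--Schwarz gives \<open>(n - 1)\<^sup>2 \<le> (\<Sum> \<lambda>\<^sub>i) (\<Sum> 1/\<lambda>\<^sub>i)\<close>. For the complete
  graph the two bounds are the same number.

  The pseudoinverse of the Laplacian \<open>L\<close> is replaced throughout by the inverse of \<open>L + J\<close>, where \<open>J\<close>
  has all entries \<open>1/n\<close>: it determines the same resistances, and its trace
  is \<open>1 + \<Sum>\<^sub>i\<^sub>\<ge>\<^sub>2 1/\<lambda>\<^sub>i\<close> (\<open>reciprocal_eigenvalue_sum_eq_trace\<close>). That trace formula carries the spectral part
  of the argument; the rest is about potentials on the graph.\<close>

section \<open>Eigenvalues of real symmetric matrices\<close>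

text \<open>If \<open>A z = k z\<close>, then \<open>z\<^sup>* A z = k \<parallel>z\<parallel>\<^sup>2\<close>, and symmetry makes the left-hand side equal to its own
  conjugate.\<close>
lemma real_symmetric_complex_eigenvalue_real:
  fixes A :: "real mat"
  assumes A: "A \<in> carrier_mat n n"
    and sym: "\<And>i j. i < n \<Longrightarrow> j < n \<Longrightarrow> A $$ (i, j) = A $$ (j, i)"
    and ev: "eigenvalue (map_mat complex_of_real A) k"
  shows "k \<in> \<real>"
proof -
  let ?B = "map_mat complex_of_real A"
  obtain z where z: "z \<in> carrier_vec n" "z \<noteq> 0\<^sub>v n" and eq: "?B *\<^sub>v z = k \<cdot>\<^sub>v z"
    using ev A unfolding eigenvalue_def eigenvector_def by auto
  have row: "(\<Sum>j<n. of_real (A $$ (i, j)) * z $ j) = k * z $ i" if "i < n" for i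
  proof -
    have "(?B *\<^sub>v z) $ i = k * z $ i" using eq z that by simp
    then show ?thesis using A z that
      by (simp add: scalar_prod_def lessThan_atLeast0)
  qed
  define q where "q = (\<Sum>i<n. \<Sum>j<n. cnj (z $ i) * of_real (A $$ (i, j)) * z $ j)"
  define N where "N = (\<Sum>i<n. (cmod (z $ i))\<^sup>2)"
  have "q = (\<Sum>i<n. cnj (z $ i) * (k * z $ i))"
    unfolding q_def
    by (intro sum.cong refl) (simp add: row[symmetric] sum_distrib_left mult.assoc)
  also have "\<dots> = k * of_real N"
    unfolding N_def of_real_sum sum_distrib_left
    by (intro sum.cong refl, subst complex_norm_square) (simp add: algebra_simps)
  finally have q: "q = k * of_real N" .
  have "cnj q = (\<Sum>i<n. \<Sum>j<n. cnj (z $ j) * of_real (A $$ (i, j)) * z $ i)"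
    unfolding q_def by (simp add: mult_ac)
  also have "\<dots> = (\<Sum>j<n. \<Sum>i<n. cnj (z $ j) * of_real (A $$ (i, j)) * z $ i)"
    by (rule sum.swap)
  also have "\<dots> = q"
    unfolding q_def by (intro sum.cong refl) (simp add: sym)
  finally have "q \<in> \<real>" by (simp add: Reals_cnj_iff)
  obtain i where i: "i < n" "z $ i \<noteq> 0" using z by (metis carrier_vecD eq_vecI index_zero_vec)
  have "N \<noteq> 0"
    unfolding N_def using i by (subst sum_nonneg_eq_0_iff) auto
  then have "k = q / of_real N" using q by simp
  with \<open>q \<in> \<real>\<close> show ?thesis by simp
qed

text \<open>Over the complex numbers the characteristic polynomial splits, and all its roots are real, so the
  factorization descends to the reals. Hence the sorted list of real roots that defines the
  \<open>i\<close>-th eigenvalue has full length, and it is a legitimate diagonal for a real Schur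
  decomposition.\<close>
lemma real_symmetric_char_poly_splits:
  fixes A :: "real mat"
  assumes A: "A \<in> carrier_mat n n"
    and sym: "\<And>i j. i < n \<Longrightarrow> j < n \<Longrightarrow> A $$ (i, j) = A $$ (j, i)"
  defines "es \<equiv> sorted_list_of_multiset (proots (char_poly A))"
  shows "char_poly A = (\<Prod>e\<leftarrow>es. [:- e, 1:])" and "length es = n"
proof -
  let ?h = "complex_of_real"
  interpret h: map_poly_inj_comm_ring_hom ?h ..
  have B: "map_mat ?h A \<in> carrier_mat n n" using A by simp
  obtain zs where zs: "char_poly (map_mat ?h A) = (\<Prod>z\<leftarrow>zs. [:- z, 1:])" and len: "length zs = n"
    using char_poly_factorized[OF B] by auto
  have real: "z = ?h (Re z)" if "z \<in> set zs" for z
  proof -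
    have "poly (char_poly (map_mat ?h A)) z = 0"
      unfolding zs using that by (simp add: poly_prod_list prod_list_zero_iff image_iff)
    then have "eigenvalue (map_mat ?h A) z" using eigenvalue_root_char_poly[OF B] by simp
    then have "z \<in> \<real>" using real_symmetric_complex_eigenvalue_real[OF A] sym by blast
    then show ?thesis by simp
  qed
  have "map_poly ?h (char_poly A) = (\<Prod>z\<leftarrow>zs. [:- z, 1:])"
    using zs by (simp add: of_real_hom.char_poly_hom[OF A])
  also have "\<dots> = (\<Prod>z\<leftarrow>zs. map_poly ?h [:- Re z, 1:])"
    using real by (intro arg_cong[where f = prod_list] map_cong refl) simp
  also have "\<dots> = map_poly ?h (\<Prod>z\<leftarrow>zs. [:- Re z, 1:])"
    by (simp add: h.hom_prod_list o_def)
  finally have cp: "char_poly A = (\<Prod>e\<leftarrow>map Re zs. [:- e, 1:])"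
    by (simp add: o_def)
  have "proots (\<Prod>e\<leftarrow>rs. [:- e, 1:]) = mset rs" for rs :: "real list"
  proof (induction rs)
    case (Cons a rs)
    have "(\<Prod>e\<leftarrow>rs. [:- e, 1:]) \<noteq> 0" by (auto simp: prod_list_zero_iff)
    then have "proots ([:- a, 1:] * (\<Prod>e\<leftarrow>rs. [:- e, 1:])) = {#a#} + mset rs"
      using Cons.IH by (subst proots_mult) auto
    then show ?case by (simp del: mult_pCons_left)
  qed simp
  then have roots: "proots (char_poly A) = mset (map Re zs)" using cp by metis
  then have es: "mset es = mset (map Re zs)" by (simp add: es_def)
  then have "mset (map (\<lambda>e. [:- e, 1:]) es) = mset (map (\<lambda>e. [:- e, 1:]) (map Re zs))"
    by (simp only: mset_map)
  then show "char_poly A = (\<Prod>e\<leftarrow>es. [:- e, 1:])"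
    unfolding cp by (simp only: prod_mset_prod_list[symmetric])
  show "length es = n" using mset_eq_length[OF es] len by simp
qed

section \<open>Traces and triangular inverses\<close>

definition trace_mat :: "'a :: comm_monoid_add mat \<Rightarrow> 'a" where
  "trace_mat A = (\<Sum>i<dim_row A. A $$ (i, i))"

lemma trace_mat_mult_commute:
  fixes A :: "'a :: comm_semiring_0 mat"
  assumes "A \<in> carrier_mat n k" "B \<in> carrier_mat k n"
  shows "trace_mat (A * B) = trace_mat (B * A)"
proof -
  have "trace_mat (A * B) = (\<Sum>i<n. \<Sum>j<k. A $$ (i, j) * B $$ (j, i))"
    using assms by (simp add: trace_mat_def scalar_prod_def lessThan_atLeast0)
  also have "\<dots> = (\<Sum>j<k. \<Sum>i<n. B $$ (j, i) * A $$ (i, j))"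
    by (subst sum.swap) (simp add: mult.commute)
  also have "\<dots> = trace_mat (B * A)"
    using assms by (simp add: trace_mat_def scalar_prod_def lessThan_atLeast0)
  finally show ?thesis .
qed

lemma trace_mat_similar:
  fixes A :: "'a :: comm_ring_1 mat"
  assumes "A \<in> carrier_mat n n" "P \<in> carrier_mat n n" "Q \<in> carrier_mat n n" "P * Q = 1\<^sub>m n"
  shows "trace_mat (Q * A * P) = trace_mat A"
proof -
  have "trace_mat (Q * A * P) = trace_mat (P * (Q * A))"
    using assms by (intro trace_mat_mult_commute) auto
  also have "P * (Q * A) = A"
    using assms by (simp add: assoc_mult_mat[symmetric, of P n n Q n A n])
  finally show ?thesis .
qed

text \<open>Comparing the columns of \<open>S T = 1\<close> from left to right shows that \<open>S\<close> is again upper triangular;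
  the diagonal entries of the product are then the products of the diagonal entries.\<close>
lemma left_inverse_upper_triangular_diag:
  fixes S T :: "'a :: field mat"
  assumes S: "S \<in> carrier_mat n n" and T: "T \<in> carrier_mat n n"
    and ut: "upper_triangular T"
    and nz: "\<And>i. i < n \<Longrightarrow> T $$ (i, i) \<noteq> 0"
    and ST: "S * T = 1\<^sub>m n" and "j < n"
  shows "S $$ (j, j) = inverse (T $$ (j, j))"
proof -
  have entry: "(\<Sum>k<n. S $$ (i, k) * T $$ (k, j)) = (if i = j then 1 else 0)"
    if "i < n" "j < n" for i j
  proof -
    have "(S * T) $$ (i, j) = (if i = j then 1 else 0)" using that by (simp add: ST)
    then show ?thesis using S T that by (simp add: scalar_prod_def lessThan_atLeast0)
  qed
  have T0: "T $$ (k, j) = 0" if "j < k" "k < n" for j k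
    using ut T that unfolding upper_triangular_def by auto
  have S0: "S $$ (i, j) = 0" if "j < i" "i < n" for i j
    using that
  proof (induction j rule: less_induct)
    case (less j)
    have "0 = (\<Sum>k<n. S $$ (i, k) * T $$ (k, j))"
      using less.prems entry[of i j] by simp
    also have "\<dots> = (\<Sum>k<n. if k = j then S $$ (i, j) * T $$ (j, j) else 0)"
    proof (intro sum.cong refl)
      fix k assume "k \<in> {..<n}"
      then show "S $$ (i, k) * T $$ (k, j) = (if k = j then S $$ (i, j) * T $$ (j, j) else 0)"
        using less.prems less.IH[of k] T0[of j k] by (cases k j rule: linorder_cases) auto
    qed
    finally show ?case using less.prems nz[of j] by simp
  qed
  have "1 = (\<Sum>k<n. S $$ (j, k) * T $$ (k, j))" using entry[of j j] \<open>j < n\<close> by simp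
  also have "\<dots> = (\<Sum>k<n. if k = j then S $$ (j, j) * T $$ (j, j) else 0)"
  proof (intro sum.cong refl)
    fix k assume "k \<in> {..<n}"
    then show "S $$ (j, k) * T $$ (k, j) = (if k = j then S $$ (j, j) * T $$ (j, j) else 0)"
      using S0[of k j] T0[of j k] \<open>j < n\<close> by (cases k j rule: linorder_cases) auto
  qed
  finally have "S $$ (j, j) * T $$ (j, j) = 1" using \<open>j < n\<close> by simp
  then show ?thesis using nz[OF \<open>j < n\<close>] by (simp add: field_simps)
qed

section \<open>Reciprocal eigenvalues as the trace of an inverse\<close>

text \<open>Let \<open>L\<close> be positive semidefinite with kernel spanned by the all-ones vector. Adding the averaging
  matrix \<open>J\<close> (all entries \<open>1/n\<close>) turns the eigenvalue \<open>0\<close> into \<open>1\<close> and leaves the other eigenvalues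
  alone, so \<open>L + J\<close> is invertible and its inverse has trace \<open>1 + \<Sum>\<^sub>i\<^sub>\<ge>\<^sub>2 1/\<lambda>\<^sub>i\<close>.

  A Schur triangularization \<open>Q L P = T\<close> with nondecreasing diagonal makes this visible. The first
  column of \<open>P\<close> lies in the kernel of \<open>L\<close>, so it is constant, and therefore the row sums of
  \<open>Q = P\<^sup>-\<^sup>1\<close> vanish except for the first. Thus \<open>Q J P\<close> has only its first row nonzero, \<open>Q (L + J) P\<close> is still upper triangular, and its diagonal is that
  of \<open>T\<close> with the leading \<open>0\<close> replaced by \<open>1\<close>.\<close>
lemma reciprocal_eigenvalue_sum_eq_trace:
  fixes L :: "real mat"
  defines "J \<equiv> mat (dim_row L) (dim_row L) (\<lambda>_. 1 / real (dim_row L))"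
  assumes L: "L \<in> carrier_mat n n" and n: "0 < n"
    and sym: "\<And>i j. i < n \<Longrightarrow> j < n \<Longrightarrow> L $$ (i, j) = L $$ (j, i)"
    and psd: "\<And>x. x \<in> carrier_vec n \<Longrightarrow> 0 \<le> x \<bullet> (L *\<^sub>v x)"
    and ker: "\<And>x i j. x \<in> carrier_vec n \<Longrightarrow> L *\<^sub>v x = 0\<^sub>v n \<Longrightarrow> i < n \<Longrightarrow> j < n \<Longrightarrow> x $ i = x $ j"
    and row0: "\<And>i. i < n \<Longrightarrow> (\<Sum>j<n. L $$ (i, j)) = 0"
  obtains G where "G \<in> carrier_mat n n" and "(L + J) * G = 1\<^sub>m n"
    and "(\<Sum>i = 2..n. inverse (nth_eigenvalue L i)) = trace_mat G - 1"
    and "(\<Sum>i = 2..n. nth_eigenvalue L i) = trace_mat L"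
    and "\<And>i. i \<in> {2..n} \<Longrightarrow> 0 < nth_eigenvalue L i"
proof -
  define es where "es = sorted_list_of_multiset (proots (char_poly L))"
  have cp: "char_poly L = (\<Prod>e\<leftarrow>es. [:- e, 1:])" and len: "length es = n"
    unfolding es_def using real_symmetric_char_poly_splits[OF L] sym by blast+
  have sorted: "sorted es" by (simp add: es_def)
  have nth_ev: "nth_eigenvalue L i = es ! (i - 1)" for i
    by (simp add: nth_eigenvalue_def es_def)
  have col0: "(\<Sum>i<n. L $$ (i, j)) = 0" if "j < n" for j
    using row0[OF that] by (subst sum.cong[OF refl sym]) (use that in auto)
  have J: "J \<in> carrier_mat n n" and Jij: "\<And>i j. i < n \<Longrightarrow> j < n \<Longrightarrow> J $$ (i, j) = 1 / real n"
    using L by (auto simp: J_def)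
  have mult_vec: "(L *\<^sub>v x) $ i = (\<Sum>j<n. L $$ (i, j) * x $ j)" if "x \<in> carrier_vec n" "i < n" for x i
    using L that by (simp add: scalar_prod_def lessThan_atLeast0)
  have ev: "eigenvalue L e \<longleftrightarrow> e \<in> set es" for e
    unfolding eigenvalue_root_char_poly[OF L] cp
    by (simp add: poly_prod_list prod_list_zero_iff image_iff)
  have es_nonneg: "0 \<le> e" if "e \<in> set es" for e
  proof -
    from that ev obtain x where x: "x \<in> carrier_vec n" "x \<noteq> 0\<^sub>v n" "L *\<^sub>v x = e \<cdot>\<^sub>v x"
      using L unfolding eigenvalue_def eigenvector_def by auto
    then have "0 \<le> e * (x \<bullet> x)" using psd[OF x(1)] by simp
    moreover have "0 < x \<bullet> x"
      using conjugate_square_greater_0_vec[of x n] x by simp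
    ultimately show ?thesis by (simp add: zero_le_mult_iff)
  qed
  have "eigenvector L (vec n (\<lambda>_. 1)) 0"
    unfolding eigenvector_def
  proof (intro conjI)
    show "vec n (\<lambda>_. 1 :: real) \<noteq> 0\<^sub>v (dim_row L)"
    proof
      assume "vec n (\<lambda>_. 1 :: real) = 0\<^sub>v (dim_row L)"
      then have "vec n (\<lambda>_. 1 :: real) $ 0 = 0\<^sub>v (dim_row L) $ 0" by simp
      with n L show False by simp
    qed
    show "L *\<^sub>v vec n (\<lambda>_. 1) = 0 \<cdot>\<^sub>v vec n (\<lambda>_. 1)"
      by (rule eq_vecI) (use L row0 in \<open>simp_all add: mult_vec del: index_mult_mat_vec\<close>)
  qed (use L in auto)
  then have "0 \<in> set es" using ev unfolding eigenvalue_def by blast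
  then have es0: "es ! 0 = 0"
  proof -
    from \<open>0 \<in> set es\<close> obtain k where k: "k < n" "es ! k = 0" using len by (auto simp: in_set_conv_nth)
    then have "es ! 0 \<le> 0" using sorted_nth_mono[OF sorted, of 0 k] len by simp
    moreover have "0 \<le> es ! 0" using es_nonneg len n by simp
    ultimately show ?thesis by simp
  qed
  obtain T P Q where schur: "schur_decomposition L es = (T, P, Q)"
    by (cases "schur_decomposition L es") auto
  have sim: "similar_mat_wit L T P Q" and ut: "upper_triangular T" and diag: "diag_mat T = es"
    using schur_decomposition[OF L cp schur] by auto
  note PQ = similar_mat_witD2[OF L sim]
  have T: "T \<in> carrier_mat n n" and P: "P \<in> carrier_mat n n" and Q: "Q \<in> carrier_mat n n"
    by fact+
  have Tii: "T $$ (i, i) = es ! i" if "i < n" for i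
    using T that by (simp add: diag[symmetric] diag_mat_def)
  have T0: "T $$ (k, j) = 0" if "j < k" "k < n" for j k
    using ut T that unfolding upper_triangular_def by auto
  have LP: "L * P = P * T"
    using PQ by (simp add: assoc_mult_mat[of _ n n _ n _ n])
  have QLP: "Q * L * P = T"
  proof -
    have "Q * L * P = Q * (P * T)" unfolding LP[symmetric] using Q L P by (rule assoc_mult_mat)
    also have "\<dots> = Q * P * T" using Q P T by (rule assoc_mult_mat[symmetric])
    also have "\<dots> = T" using PQ(2) T by simp
    finally show ?thesis .
  qed
  have LP_entry: "(\<Sum>k<n. L $$ (i, k) * P $$ (k, j)) = (\<Sum>k<n. P $$ (i, k) * T $$ (k, j))"
    if "i < n" "j < n" for i j
  proof -
    have "(L * P) $$ (i, j) = (P * T) $$ (i, j)" using LP by simp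
    then show ?thesis using L P T that by (simp add: scalar_prod_def lessThan_atLeast0)
  qed
  have QP_entry: "(\<Sum>k<n. Q $$ (i, k) * P $$ (k, j)) = (if i = j then 1 else 0)"
    if "i < n" "j < n" for i j
  proof -
    have "(Q * P) $$ (i, j) = (if i = j then 1 else 0)" using PQ that by simp
    then show ?thesis using Q P that by (simp add: scalar_prod_def lessThan_atLeast0)
  qed
  have const_col: "P $$ (i, j) = P $$ (0, j)"
    if "j < n" "i < n" and "\<And>i. i < n \<Longrightarrow> (\<Sum>k<n. L $$ (i, k) * P $$ (k, j)) = 0" for i j
  proof -
    have "L *\<^sub>v col P j = 0\<^sub>v n"
      by (rule eq_vecI) (use L P that in \<open>simp_all add: mult_vec del: index_mult_mat_vec\<close>)
    from ker[OF _ this, of i 0] show ?thesis using P that n by simp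
  qed
  define c where "c = P $$ (0, 0)"
  have P0: "P $$ (i, 0) = c" if "i < n" for i
    unfolding c_def
  proof (rule const_col[OF n that])
    fix i assume i: "i < n"
    have "(\<Sum>k<n. P $$ (i, k) * T $$ (k, 0)) = 0"
    proof (intro sum.neutral ballI)
      fix k assume "k \<in> {..<n}"
      then show "P $$ (i, k) * T $$ (k, 0) = 0"
        using T0[of 0 k] Tii[OF n] es0 by (cases "k = 0") auto
    qed
    then show "(\<Sum>k<n. L $$ (i, k) * P $$ (k, 0)) = 0" using LP_entry[OF i n] by simp
  qed
  \<comment> \<open>\<open>q\<close> is the vector of row sums of \<open>Q\<close>, that is, \<open>Q\<close> applied to the all-ones vector.\<close>
  define q where "q i = (\<Sum>k<n. Q $$ (i, k))" for i
  have qc: "q i * c = (if i = 0 then 1 else 0)" if "i < n" for i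
    using QP_entry[OF that n] by (simp add: P0 q_def sum_distrib_right)
  have c: "c \<noteq> 0" using qc[OF n] by auto
  have q0: "q i = 0" if "0 < i" "i < n" for i using qc[of i] that c by simp
  have es_pos: "0 < es ! i" if i: "1 \<le> i" "i < n" for i
  proof -
    \<comment> \<open>If \<open>0\<close> were a double root, then \<open>L\<close> would map the second column of \<open>P\<close> to a constant
        vector; the columns of \<open>L\<close> sum to zero, so that constant is zero, and the second column of
        \<open>P\<close> would be proportional to the first.\<close>
    have "es ! 1 \<noteq> 0"
    proof
      assume z: "es ! 1 = 0"
      have n1: "1 < n" using i by simp
      have "(\<Sum>k<n. P $$ (i, k) * T $$ (k, 1)) = c * T $$ (0, 1)" if "i < n" for i
      proof -
        have "(\<Sum>k<n. P $$ (i, k) * T $$ (k, 1)) = (\<Sum>k<n. if k = 0 then c * T $$ (0, 1) else 0)"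
        proof (intro sum.cong refl)
          fix k assume "k \<in> {..<n}"
          then show "P $$ (i, k) * T $$ (k, 1) = (if k = 0 then c * T $$ (0, 1) else 0)"
            using T0[of 1 k] Tii[OF n1] z P0[OF that] by (cases "k = 0"; cases "k = 1") auto
        qed
        then show ?thesis using n by simp
      qed
      then have LP1: "(\<Sum>k<n. L $$ (i, k) * P $$ (k, 1)) = c * T $$ (0, 1)" if "i < n" for i
        using LP_entry[OF that n1] that by simp
      have "real n * (c * T $$ (0, 1)) = (\<Sum>i<n. \<Sum>k<n. L $$ (i, k) * P $$ (k, 1))"
        using LP1 by simp
      also have "\<dots> = (\<Sum>k<n. (\<Sum>i<n. L $$ (i, k)) * P $$ (k, 1))"
        by (subst sum.swap) (simp add: sum_distrib_right)
      also have "\<dots> = 0" by (simp add: col0)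
      finally have "c * T $$ (0, 1) = 0" using n by simp
      then have "P $$ (k, 1) = P $$ (0, 1)" if "k < n" for k
        using const_col[OF n1 that] LP1 by simp
      then obtain d where P1: "\<And>k. k < n \<Longrightarrow> P $$ (k, 1) = d" by blast
      have "q 1 * d = (\<Sum>k<n. Q $$ (1, k) * P $$ (k, 1))"
        unfolding q_def sum_distrib_right by (intro sum.cong refl) (simp only: P1 lessThan_iff)
      then have "q 1 * d = 1" using QP_entry[OF n1 n1] by simp
      with q0[of 1] n1 show False by simp
    qed
    moreover have "0 \<le> es ! 1" using es_nonneg len i by simp
    moreover have "es ! 1 \<le> es ! i" using sorted len i by (simp add: sorted_iff_nth_mono)
    ultimately show ?thesis by simp
  qed
  define p where "p j = (\<Sum>k<n. P $$ (k, j)) / real n" for j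
  have QJP: "(Q * J * P) $$ (i, j) = q i * p j" if "i < n" "j < n" for i j
  proof -
    have "(Q * J) $$ (i, k) = q i / real n" if "k < n" for k
      using Q J \<open>i < n\<close> that
      by (simp add: scalar_prod_def lessThan_atLeast0 Jij q_def sum_divide_distrib)
    moreover have "(Q * J * P) $$ (i, j) = (\<Sum>k<n. (Q * J) $$ (i, k) * P $$ (k, j))"
      using Q J P that
      by (simp add: scalar_prod_def lessThan_atLeast0 del: assoc_mult_mat)
    ultimately show ?thesis
      by (simp add: p_def sum_distrib_left sum_divide_distrib del: index_mult_mat assoc_mult_mat)
  qed
  have pq: "q 0 * p 0 = 1" using qc[OF n] n P0 by (simp add: p_def)
  define T' where "T' = Q * (L + J) * P"
  have LJ: "L + J \<in> carrier_mat n n" using L J by simp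
  note mult_closed = mult_carrier_mat[of _ n n _ n] and mult_assoc = assoc_mult_mat[of _ n n _ n _ n]
  have T': "T' \<in> carrier_mat n n" unfolding T'_def by (intro mult_closed P Q LJ)
  have "T' = T + Q * J * P"
    unfolding T'_def QLP[symmetric] mult_add_distrib_mat[OF Q L J]
    by (intro add_mult_distrib_mat[of _ n n _ _ n] mult_closed P Q L J)
  then have T'_entry: "T' $$ (i, j) = T $$ (i, j) + q i * p j" if "i < n" "j < n" for i j
    using that P Q J T by (simp add: QJP del: index_mult_mat(1) assoc_mult_mat)
  have ut': "upper_triangular T'"
    unfolding upper_triangular_def using T' T'_entry T0 q0 by auto
  have T'_diag: "T' $$ (i, i) = (if i = 0 then 1 else es ! i)" if "i < n" for i
    using that T'_entry Tii q0 es0 pq by simp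
  have nz: "T' $$ (i, i) \<noteq> 0" if "i < n" for i
    using T'_diag[OF that] es_pos[of i] that by (cases "i = 0") auto
  have "det T' \<noteq> 0"
    using det_upper_triangular[OF ut' T'] nz T'
    by (auto simp: prod_list_zero_iff diag_mat_def)
  then obtain S where S: "S \<in> carrier_mat n n" and ST: "S * T' = 1\<^sub>m n" and TS: "T' * S = 1\<^sub>m n"
    using det_non_zero_imp_unit[OF T', of "()"] by (auto simp: Units_def ring_mat_def)
  define G where "G = P * S * Q"
  have G: "G \<in> carrier_mat n n" using P S Q by (simp add: G_def)
  have "L + J = P * T' * Q"
  proof -
    have "P * T' * Q = (P * Q) * (L + J) * (P * Q)"
      unfolding T'_def using P Q LJ by (simp add: mult_assoc mult_closed)
    then show ?thesis
      by (simp only: PQ(1) left_mult_one_mat[OF LJ] right_mult_one_mat[OF LJ])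
  qed
  then have "(L + J) * G = P * (T' * ((Q * P) * S)) * Q"
    unfolding G_def using P Q S T' by (simp add: mult_assoc mult_closed)
  also have "\<dots> = 1\<^sub>m n" using PQ S P Q TS by simp
  finally have LJG: "(L + J) * G = 1\<^sub>m n" .
  have shift: "(\<Sum>i = 2..n. f (i - 1)) = (\<Sum>i = 1..<n. f i)" for f :: "nat \<Rightarrow> real"
    by (rule sum.reindex_bij_witness[of _ Suc "\<lambda>i. i - 1"]) auto
  have split0: "(\<Sum>i<n. f i) = f 0 + (\<Sum>i = 1..<n. f i)" for f :: "nat \<Rightarrow> real"
    using n by (simp add: lessThan_atLeast0 sum.atLeast_Suc_lessThan)
  have "trace_mat G = trace_mat S"
    unfolding G_def using trace_mat_similar[OF S Q P] PQ by simp
  also have "\<dots> = (\<Sum>i<n. inverse (T' $$ (i, i)))"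
    using S left_inverse_upper_triangular_diag[OF S T' ut' nz ST] by (simp add: trace_mat_def)
  also have "\<dots> = 1 + (\<Sum>i = 1..<n. inverse (es ! i))"
    unfolding split0 using n by (simp add: T'_diag)
  finally have trG: "(\<Sum>i = 2..n. inverse (nth_eigenvalue L i)) = trace_mat G - 1"
    unfolding nth_ev using shift[of "\<lambda>i. inverse (es ! i)"] by simp
  have "trace_mat L = trace_mat T"
    using trace_mat_similar[OF L P Q] PQ QLP by simp
  also have "\<dots> = (\<Sum>i = 1..<n. es ! i)"
    using T by (simp add: trace_mat_def Tii split0 es0)
  finally have trL: "(\<Sum>i = 2..n. nth_eigenvalue L i) = trace_mat L"
    unfolding nth_ev using shift[of "\<lambda>i. es ! i"] by simp
  have "0 < nth_eigenvalue L i" if "i \<in> {2..n}" for i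
    unfolding nth_ev using that by (intro es_pos) auto
  with G LJG trG trL show ?thesis by (rule that)
qed

section \<open>A weighted Cauchy--Schwarz inequality\<close>

text \<open>The weighted variance \<open>\<Sum> a\<^sub>i (t\<^sub>i/a\<^sub>i - s)\<^sup>2\<close> around the mean \<open>s = \<Sum>t\<^sub>i / \<Sum>a\<^sub>i\<close> is nonnegative. The case \<open>a = 1\<close> is
  used along walks, the case \<open>t = 1\<close> (harmonic against arithmetic mean) on the spectrum.\<close>
lemma sum_squared_le_weighted_sum:
  fixes a t :: "'i \<Rightarrow> real"
  assumes pos: "\<And>i. i \<in> I \<Longrightarrow> 0 < a i"
  shows "(\<Sum>i\<in>I. t i)\<^sup>2 \<le> (\<Sum>i\<in>I. a i) * (\<Sum>i\<in>I. (t i)\<^sup>2 / a i)"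
proof (cases "finite I \<and> I \<noteq> {}")
  case True
  define W where "W = (\<Sum>i\<in>I. a i)"
  define s where "s = (\<Sum>i\<in>I. t i) / W"
  have W: "0 < W" unfolding W_def using True pos by (intro sum_pos) auto
  have "0 \<le> (\<Sum>i\<in>I. a i * (t i / a i - s)\<^sup>2)"
    using pos by (intro sum_nonneg) (simp add: less_imp_le)
  also have "\<dots> = (\<Sum>i\<in>I. (t i)\<^sup>2 / a i - 2 * s * t i + s\<^sup>2 * a i)"
  proof (intro sum.cong refl)
    fix i assume "i \<in> I"
    from pos[OF this] show "a i * (t i / a i - s)\<^sup>2 = (t i)\<^sup>2 / a i - 2 * s * t i + s\<^sup>2 * a i"
      by (simp add: field_simps power2_eq_square)
  qed
  also have "\<dots> = (\<Sum>i\<in>I. (t i)\<^sup>2 / a i) - 2 * s * (s * W) + s\<^sup>2 * W"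
  proof -
    have "s * W = (\<Sum>i\<in>I. t i)" using W by (simp add: s_def)
    then show ?thesis by (simp add: sum.distrib sum_subtractf sum_distrib_left[symmetric] W_def)
  qed
  finally have "s\<^sup>2 * W \<le> (\<Sum>i\<in>I. (t i)\<^sup>2 / a i)"
    by (simp add: power2_eq_square algebra_simps)
  then have "W * (s\<^sup>2 * W) \<le> W * (\<Sum>i\<in>I. (t i)\<^sup>2 / a i)"
    using W by (intro mult_left_mono) auto
  moreover have "W * (s\<^sup>2 * W) = (\<Sum>i\<in>I. t i)\<^sup>2" using W by (simp add: s_def power2_eq_square)
  ultimately show ?thesis by (simp add: W_def)
qed auto

section \<open>Dirichlet energy and distances\<close>

lemma simple_graph_edgeD:
  assumes "simple_graph V E" "{u, v} \<in> E"
  shows "u \<in> V" "v \<in> V" "u \<noteq> v"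
  using assms unfolding simple_graph_def by fastforce+

lemma finite_edges: "simple_graph V E \<Longrightarrow> finite E"
  unfolding simple_graph_def by (meson Pow_iff finite_Pow_iff finite_subset subsetI)

lemma degree_of_eq_card_neighbours:
  assumes "simple_graph V E"
  shows "degree_of E u = card {v \<in> V. {u, v} \<in> E}"
proof -
  have "bij_betw (\<lambda>v. {u, v}) {v \<in> V. {u, v} \<in> E} {e \<in> E. u \<in> e}"
  proof (rule bij_betwI')
    fix e assume "e \<in> {e \<in> E. u \<in> e}"
    then have e: "e \<in> E" "u \<in> e" and "card e = 2" "e \<subseteq> V"
      using assms unfolding simple_graph_def by auto
    then obtain v where "e = {u, v}" by (auto simp: card_2_iff doubleton_eq_iff)
    then show "\<exists>v\<in>{v \<in> V. {u, v} \<in> E}. e = {u, v}" using e \<open>e \<subseteq> V\<close> by auto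
  qed (auto simp: doubleton_eq_iff)
  then show ?thesis unfolding degree_of_def by (simp add: bij_betw_same_card)
qed

lemma sum_degree_of:
  assumes "simple_graph V E"
  shows "(\<Sum>v\<in>V. degree_of E v) = 2 * card E"
  unfolding degree_of_def
proof (rule sum_multicount)
  show "\<forall>e\<in>E. card {v \<in> V. v \<in> e} = 2"
  proof
    fix e assume "e \<in> E"
    then have "e \<subseteq> V" "card e = 2" using assms unfolding simple_graph_def by auto
    moreover from this have "{v \<in> V. v \<in> e} = e" by auto
    ultimately show "card {v \<in> V. v \<in> e} = 2" by simp
  qed
qed (use assms finite_edges in \<open>auto simp: simple_graph_def\<close>)

abbreviation adj :: "'a set set \<Rightarrow> 'a \<Rightarrow> 'a \<Rightarrow> real" where
  "adj E u v \<equiv> of_bool ({u, v} \<in> E)"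

definition laplacian_op :: "'a set \<Rightarrow> 'a set set \<Rightarrow> ('a \<Rightarrow> real) \<Rightarrow> 'a \<Rightarrow> real" where
  "laplacian_op V E x u = (\<Sum>v\<in>V. adj E u v * (x u - x v))"

text \<open>The factor \<open>1/2\<close> compensates that every edge occurs as two ordered pairs.\<close>
definition dirichlet_energy :: "'a set \<Rightarrow> 'a set set \<Rightarrow> ('a \<Rightarrow> real) \<Rightarrow> real" where
  "dirichlet_energy V E x = (\<Sum>u\<in>V. \<Sum>v\<in>V. adj E u v * (x u - x v)\<^sup>2) / 2"

lemma sum_adj:
  assumes "simple_graph V E"
  shows "(\<Sum>v\<in>V. adj E u v) = real (degree_of E u)"
proof -
  have "finite V" using assms by (simp add: simple_graph_def)
  then show ?thesis
    by (simp add: degree_of_eq_card_neighbours[OF assms] sum.If_cases of_bool_def Int_def)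
qed

text \<open>Summation by parts: expanding \<open>(x\<^sub>u - x\<^sub>v)\<^sup>2\<close> gives two sums that are exchanged by swapping \<open>u\<close> and
  \<open>v\<close>.\<close>
lemma dirichlet_energy_eq:
  "dirichlet_energy V E x = (\<Sum>u\<in>V. x u * laplacian_op V E x u)"
proof -
  let ?A = "\<Sum>u\<in>V. \<Sum>v\<in>V. adj E u v * (x u * (x u - x v))"
  let ?B = "\<Sum>u\<in>V. \<Sum>v\<in>V. adj E u v * (x v * (x v - x u))"
  have "?A = ?B"
    by (subst sum.swap) (intro sum.cong refl, simp add: insert_commute)
  have "(\<Sum>u\<in>V. \<Sum>v\<in>V. adj E u v * (x u - x v)\<^sup>2) = ?A + ?B"
    unfolding sum.distrib[symmetric] by (intro sum.cong refl) (simp add: algebra_simps power2_eq_square)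
  then show ?thesis
    unfolding dirichlet_energy_def laplacian_op_def \<open>?A = ?B\<close>[symmetric]
    by (simp add: sum_distrib_left algebra_simps)
qed

lemma dirichlet_energy_nonneg: "0 \<le> dirichlet_energy V E x"
  unfolding dirichlet_energy_def by (intro divide_nonneg_nonneg sum_nonneg) auto

text \<open>A repeated node would allow a shortcut, so a walk of minimal length visits each node once. This
  is what guarantees below that it uses every edge at most once.\<close>
lemma shortest_walk:
  assumes "connected_graph V E" "u \<in> V" "v \<in> V"
  defines "d \<equiv> graph_dist E u v"
  obtains p where "p 0 = u" "p d = v" "\<And>i. i < d \<Longrightarrow> {p i, p (Suc i)} \<in> E" "inj_on p {..d}"
proof -
  let ?R = "adj_rel E"
  have "\<exists>k. (u, v) \<in> ?R ^^ k"
    using assms unfolding connected_graph_def by (metis rtrancl_imp_relpow)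
  then have "(u, v) \<in> ?R ^^ d" unfolding d_def graph_dist_def by (rule LeastI_ex)
  then obtain p where p: "p 0 = u" "p d = v" "\<And>i. i < d \<Longrightarrow> (p i, p (Suc i)) \<in> ?R"
    by (auto simp: relpow_fun_conv)
  have walk: "(p i, p (i + k)) \<in> ?R ^^ k" if "i + k \<le> d" for i k
    unfolding relpow_fun_conv using p(3) that by (intro exI[of _ "\<lambda>m. p (i + m)"]) auto
  have noteq: "p i \<noteq> p j" if "i < j" "j \<le> d" for i j
  proof
    assume eq: "p i = p j"
    have "(u, p i) \<in> ?R ^^ i" using walk[of 0 i] that p by simp
    moreover have "(p i, v) \<in> ?R ^^ (d - j)" using walk[of j "d - j"] that p eq by simp
    ultimately have "(u, v) \<in> ?R ^^ (i + (d - j))" by (auto simp: relpow_add)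
    then have "d \<le> i + (d - j)" unfolding d_def graph_dist_def by (rule Least_le)
    with that show False by simp
  qed
  have "inj_on p {..d}"
    by (rule linorder_inj_onI) (use noteq in auto)
  with p show ?thesis by (intro that[of p]) (auto simp: adj_rel_def)
qed

text \<open>Along a shortest walk from \<open>u\<close> to \<open>v\<close> the increments of \<open>x\<close> telescope to \<open>x u - x v\<close>. Cauchy--Schwarz
  bounds the square by the length times the sum of squared increments, and the latter is part of
  the energy because the edges of the walk are distinct.\<close>
lemma potential_difference_le:
  assumes G: "simple_graph V E" and C: "connected_graph V E" and "u \<in> V" "v \<in> V"
  shows "(x u - x v)\<^sup>2 \<le> real (graph_dist E u v) * dirichlet_energy V E x"
proof -
  let ?d = "graph_dist E u v"
  obtain p where p: "p 0 = u" "p ?d = v" "\<And>i. i < ?d \<Longrightarrow> {p i, p (Suc i)} \<in> E" "inj_on p {..?d}"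
    using shortest_walk[OF C assms(3,4)] by blast
  have finV: "finite V" using G by (simp add: simple_graph_def)
  define t where "t i = x (p i) - x (p (Suc i))" for i
  define h where "h = (\<lambda>(a, b). adj E a b * (x a - x b)\<^sup>2)"
  \<comment> \<open>Both orientations of the walk's edges are needed, since the energy halves a sum over ordered
      pairs.\<close>
  define fw where "fw = (\<lambda>i. (p i, p (Suc i)))"
  define bw where "bw = (\<lambda>i. (p (Suc i), p i))"
  have peq: "p i = p j \<longleftrightarrow> i = j" if "i \<le> ?d" "j \<le> ?d" for i j
    using p(4) that by (auto simp: inj_on_def)
  have inj: "inj_on fw {..<?d}" "inj_on bw {..<?d}"
    by (auto simp: inj_on_def fw_def bw_def peq)
  have disj: "fw ` {..<?d} \<inter> bw ` {..<?d} = {}"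
    by (auto simp: fw_def bw_def peq)
  have sub: "fw ` {..<?d} \<union> bw ` {..<?d} \<subseteq> V \<times> V"
    using simple_graph_edgeD[OF G p(3)] by (auto simp: fw_def bw_def)
  have hfw: "h (fw i) = (t i)\<^sup>2" and hbw: "h (bw i) = (t i)\<^sup>2" if "i < ?d" for i
    using p(3)[OF that] by (auto simp: h_def fw_def bw_def t_def insert_commute power2_commute)
  have "2 * (\<Sum>i<?d. (t i)\<^sup>2) = (\<Sum>i<?d. h (fw i)) + (\<Sum>i<?d. h (bw i))"
    using hfw hbw by simp
  also have "\<dots> = sum h (fw ` {..<?d} \<union> bw ` {..<?d})"
    using inj disj by (simp add: sum.union_disjoint sum.reindex)
  also have "\<dots> \<le> sum h (V \<times> V)"
    using sub finV by (intro sum_mono2) (auto simp: h_def)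
  also have "\<dots> = 2 * dirichlet_energy V E x"
    by (simp add: h_def dirichlet_energy_def sum.cartesian_product)
  finally have energy: "(\<Sum>i<?d. (t i)\<^sup>2) \<le> dirichlet_energy V E x" by simp
  have "x u - x v = (\<Sum>i<?d. t i)"
    using p(1,2) sum_lessThan_telescope'[of "\<lambda>i. x (p i)" ?d] by (simp add: t_def)
  then have "(x u - x v)\<^sup>2 \<le> real ?d * (\<Sum>i<?d. (t i)\<^sup>2)"
    using sum_squared_le_weighted_sum[of "{..<?d}" "\<lambda>_. 1" t] by simp
  also have "\<dots> \<le> real ?d * dirichlet_energy V E x"
    using energy by (intro mult_left_mono) auto
  finally show ?thesis .
qed

lemma graph_dist_le_diam:
  assumes "finite V" "u \<in> V" "v \<in> V"
  shows "graph_dist E u v \<le> graph_diam V E"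
proof -
  have "{graph_dist E u v |u v. u \<in> V \<and> v \<in> V} = (\<lambda>(u, v). graph_dist E u v) ` (V \<times> V)" by auto
  then have "finite {graph_dist E u v |u v. u \<in> V \<and> v \<in> V}" using assms by simp
  then show ?thesis unfolding graph_diam_def using assms by (intro Max_ge) auto
qed

lemma graph_diam_star_le_2:
  assumes "finite V" "c \<in> V"
  shows "graph_diam V (star_edges V c) \<le> 2"
proof -
  let ?E = "star_edges V c"
  have "graph_dist ?E u v \<le> 2" if "u \<in> V" "v \<in> V" for u v
  proof -
    have edge: "(w, c) \<in> adj_rel ?E" "(c, w) \<in> adj_rel ?E" if "w \<in> V" "w \<noteq> c" for w
      using that by (auto simp: adj_rel_def star_edges_def)
    have "\<exists>k\<le>2. (u, v) \<in> adj_rel ?E ^^ k"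
    proof (cases "u = v")
      case True
      then show ?thesis by (intro exI[of _ 0]) auto
    next
      case neq: False
      show ?thesis
      proof (cases "u = c \<or> v = c")
        case True
        then have "(u, v) \<in> adj_rel ?E ^^ 1" using edge neq that by auto
        then show ?thesis using one_le_numeral by blast
      next
        case False
        then have "(u, v) \<in> adj_rel ?E ^^ 2" using edge that by (auto simp: numeral_2_eq_2)
        then show ?thesis by blast
      qed
    qed
    then show ?thesis unfolding graph_dist_def by (meson Least_le order_trans)
  qed
  moreover have "{graph_dist ?E u v |u v. u \<in> V \<and> v \<in> V} = (\<lambda>(u, v). graph_dist ?E u v) ` (V \<times> V)"
    by auto
  ultimately show ?thesis unfolding graph_diam_def using assms by (subst Max_le_iff) auto
qed

section \<open>Effective resistances\<close>

text \<open>Entrywise form of \<open>g = (L + J)\<^sup>-\<^sup>1\<close>: the columns of \<open>g\<close> sum to \<open>1\<close> because the columns of \<open>L\<close> sum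
  to \<open>0\<close>, hence \<open>J g = J\<close> and \<open>L g = 1 - J\<close>.\<close>
locale shifted_green =
  fixes V :: "'a set" and E :: "'a set set" and g :: "'a \<Rightarrow> 'a \<Rightarrow> real"
  assumes graph: "simple_graph V E" and connected: "connected_graph V E"
    and green: "\<And>u w. u \<in> V \<Longrightarrow> w \<in> V \<Longrightarrow>
      laplacian_op V E (\<lambda>v. g v w) u = of_bool (u = w) - 1 / real (card V)"
    and column_sum: "\<And>w. w \<in> V \<Longrightarrow> (\<Sum>u\<in>V. g u w) = 1"
begin

text \<open>The effective resistance of the network with unit conductances: inject a unit current at \<open>u\<close>,
  extract it at \<open>v\<close>, and measure the voltage between the two. Adding a constant to all entries
  of \<open>g\<close> cancels here, so this shifted inverse gives the same values as the pseudoinverse of \<open>L\<close>.\<close>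
definition resistance :: "'a \<Rightarrow> 'a \<Rightarrow> real" where
  "resistance u v = g u u - g u v - g v u + g v v"

lemma finV: "finite V" and V_ne: "V \<noteq> {}"
  using graph connected by (auto simp: simple_graph_def connected_graph_def)

lemma laplacian_dipole_potential:
  assumes "u \<in> V" "v \<in> V" "w \<in> V"
  shows "laplacian_op V E (\<lambda>z. g z u - g z v) w = of_bool (w = u) - of_bool (w = v)"
proof -
  have "laplacian_op V E (\<lambda>z. g z u - g z v) w
      = laplacian_op V E (\<lambda>z. g z u) w - laplacian_op V E (\<lambda>z. g z v) w"
    by (simp add: laplacian_op_def sum_subtractf[symmetric] algebra_simps)
  with green assms show ?thesis by simp
qed

text \<open>Dissipated power equals voltage times current, and the current is one.\<close>
lemma dipole_energy:
  assumes "u \<in> V" "v \<in> V"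
  shows "dirichlet_energy V E (\<lambda>z. g z u - g z v) = resistance u v"
proof -
  have "dirichlet_energy V E (\<lambda>z. g z u - g z v)
      = (\<Sum>w\<in>V. (g w u - g w v) * (of_bool (w = u) - of_bool (w = v)))"
    unfolding dirichlet_energy_eq using assms
    by (intro sum.cong refl) (simp add: laplacian_dipole_potential)
  also have "\<dots> = (\<Sum>w\<in>V. if w = u then g w u - g w v else 0)
      - (\<Sum>w\<in>V. if w = v then g w u - g w v else 0)"
    unfolding sum_subtractf[symmetric] by (intro sum.cong refl) auto
  also have "\<dots> = resistance u v"
    using assms finV by (simp add: resistance_def)
  finally show ?thesis .
qed

text \<open>With the dipole potential as test function, voltage and energy are both the resistance \<open>r\<close>, so
  the bound on potential differences reads \<open>r\<^sup>2 \<le> d r\<close>.\<close>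
lemma resistance_le_dist:
  assumes "u \<in> V" "v \<in> V"
  shows "resistance u v \<le> real (graph_dist E u v)"
proof -
  let ?x = "\<lambda>z. g z u - g z v"
  have "(resistance u v)\<^sup>2 \<le> real (graph_dist E u v) * resistance u v"
    using potential_difference_le[OF graph connected assms, of ?x] dipole_energy[OF assms]
    by (simp add: resistance_def algebra_simps)
  moreover have "0 \<le> resistance u v"
    using dirichlet_energy_nonneg[of V E ?x] dipole_energy[OF assms] by simp
  ultimately show ?thesis
    by (cases "resistance u v = 0") (auto simp: power2_eq_square)
qed

text \<open>Foster's theorem: summed over the edges, the resistances are the trace of \<open>L g = 1 - J\<close>, which is
  \<open>n - 1\<close>. The factor \<open>2\<close> comes from the ordered pairs.\<close>
lemma sum_resistance_edges:
  "(\<Sum>u\<in>V. \<Sum>v\<in>V. adj E u v * resistance u v) = 2 * (real (card V) - 1)"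
proof -
  let ?A = "\<Sum>u\<in>V. \<Sum>v\<in>V. adj E u v * (g u u - g v u)"
  let ?B = "\<Sum>u\<in>V. \<Sum>v\<in>V. adj E u v * (g v v - g u v)"
  have "?A = ?B"
    by (subst sum.swap) (intro sum.cong refl, simp add: insert_commute)
  have "(\<Sum>u\<in>V. \<Sum>v\<in>V. adj E u v * resistance u v) = ?A + ?B"
    unfolding sum.distrib[symmetric]
    by (intro sum.cong refl) (simp add: resistance_def algebra_simps)
  also have "\<dots> = 2 * ?A" using \<open>?A = ?B\<close> by simp
  also have "?A = (\<Sum>u\<in>V. 1 - 1 / real (card V))"
    using green by (intro sum.cong refl) (simp add: laplacian_op_def)
  also have "\<dots> = real (card V) - 1"
    using finV V_ne by (simp add: right_diff_distrib)
  finally show ?thesis .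
qed

lemma sum_resistance_all:
  "(\<Sum>u\<in>V. \<Sum>v\<in>V. resistance u v) = 2 * real (card V) * ((\<Sum>v\<in>V. g v v) - 1)"
proof -
  have "(\<Sum>u\<in>V. \<Sum>v\<in>V. g v u) = real (card V)" by (simp add: column_sum)
  moreover have "(\<Sum>u\<in>V. \<Sum>v\<in>V. g u v) = real (card V)"
    by (subst sum.swap) (simp add: column_sum)
  ultimately show ?thesis
    by (simp add: resistance_def sum.distrib sum_subtractf sum_distrib_left[symmetric] algebra_simps)
qed

definition nonadj :: "'a \<Rightarrow> 'a \<Rightarrow> real" where
  "nonadj u v = of_bool (u \<noteq> v \<and> {u, v} \<notin> E)"

lemma adj_split: "1 = of_bool (u = v) + adj E u v + nonadj u v"
  using simple_graph_edgeD(3)[OF graph, of u v] by (auto simp: nonadj_def)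

lemma sum_nonadj:
  "(\<Sum>u\<in>V. \<Sum>v\<in>V. nonadj u v) = 2 * (real (card V choose 2) - real (card E))"
proof -
  have "(\<Sum>u\<in>V. \<Sum>v\<in>V. nonadj u v) = (\<Sum>u\<in>V. \<Sum>v\<in>V. 1 - of_bool (u = v) - adj E u v)"
    using adj_split by (intro sum.cong refl) (simp add: algebra_simps)
  also have "\<dots> = (real (card V))\<^sup>2 - real (card V) - (\<Sum>u\<in>V. real (degree_of E u))"
    using finV by (simp add: sum_subtractf sum_adj[OF graph] power2_eq_square sum.If_cases of_bool_def[of "_ = _"]
        right_diff_distrib)
  also have "(\<Sum>u\<in>V. real (degree_of E u)) = 2 * real (card E)"
    using sum_degree_of[OF graph] by (metis of_nat_mult of_nat_numeral of_nat_sum)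
  also have "(real (card V))\<^sup>2 - real (card V) = 2 * real (card V choose 2)"
    by (cases "card V") (simp_all add: choose_two real_of_nat_div power2_eq_square algebra_simps)
  finally show ?thesis by simp
qed

text \<open>The sum of all resistances expresses the trace, and by Foster's theorem the edges together
  contribute the same amount in every connected graph on the same number of nodes. Both the upper
  bound and its equality case therefore come down to the pairs of nonadjacent nodes.\<close>
lemma trace_resistance_split:
  "2 * real (card V) * ((\<Sum>v\<in>V. g v v) - 1)
    = 2 * (real (card V) - 1) + (\<Sum>u\<in>V. \<Sum>v\<in>V. nonadj u v * resistance u v)"
proof -
  have "resistance u v = adj E u v * resistance u v + nonadj u v * resistance u v" for u v
  proof -
    have "resistance u v = (of_bool (u = v) + adj E u v + nonadj u v) * resistance u v"
      using adj_split[of u v] by simp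
    moreover have "of_bool (u = v) * resistance u v = 0" by (simp add: resistance_def)
    ultimately show ?thesis by (simp only: distrib_right add_0_left)
  qed
  then have "(\<Sum>u\<in>V. \<Sum>v\<in>V. resistance u v)
      = (\<Sum>u\<in>V. \<Sum>v\<in>V. adj E u v * resistance u v + nonadj u v * resistance u v)"
    by (intro sum.cong refl)
  then show ?thesis
    by (simp add: sum.distrib sum_resistance_edges sum_resistance_all)
qed

lemma trace_upper_bound:
  "2 * real (card V) * ((\<Sum>v\<in>V. g v v) - 1)
    \<le> 2 * (real (card V) - 1 + (real (card V choose 2) - real (card E)) * real (graph_diam V E))"
proof -
  have "(\<Sum>u\<in>V. \<Sum>v\<in>V. nonadj u v * resistance u v)
      \<le> (\<Sum>u\<in>V. \<Sum>v\<in>V. nonadj u v * real (graph_diam V E))"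
  proof (intro sum_mono mult_left_mono)
    fix u v assume "u \<in> V" "v \<in> V"
    then show "resistance u v \<le> real (graph_diam V E)"
      using resistance_le_dist[of u v] graph_dist_le_diam[OF finV, of u v E] by linarith
  qed (simp add: nonadj_def)
  also have "\<dots> = 2 * (real (card V choose 2) - real (card E)) * real (graph_diam V E)"
    by (simp add: sum_distrib_right[symmetric] sum_nonadj)
  finally show ?thesis unfolding trace_resistance_split by (simp add: algebra_simps)
qed

lemma trace_eq_if_nonadjacent_resistance_eq_diam:
  assumes "\<And>u v. u \<in> V \<Longrightarrow> v \<in> V \<Longrightarrow> u \<noteq> v \<Longrightarrow> {u, v} \<notin> E
    \<Longrightarrow> resistance u v = real (graph_diam V E)"
  shows "2 * real (card V) * ((\<Sum>v\<in>V. g v v) - 1)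
    = 2 * (real (card V) - 1 + (real (card V choose 2) - real (card E)) * real (graph_diam V E))"
proof -
  have "(\<Sum>u\<in>V. \<Sum>v\<in>V. nonadj u v * resistance u v)
      = (\<Sum>u\<in>V. \<Sum>v\<in>V. nonadj u v * real (graph_diam V E))"
    using assms by (intro sum.cong refl) (auto simp: nonadj_def)
  also have "\<dots> = 2 * (real (card V choose 2) - real (card E)) * real (graph_diam V E)"
    by (simp add: sum_distrib_right[symmetric] sum_nonadj)
  finally show ?thesis unfolding trace_resistance_split by (simp add: algebra_simps)
qed

text \<open>A leaf has the centre as its only neighbour, so the Laplacian at the leaf is the voltage
  drop along its single edge.\<close>
lemma star_leaf_drop:
  assumes "c \<in> V" "E = star_edges V c" "u \<in> V" "v \<in> V" "l \<in> V" "l \<noteq> c"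
  shows "(g l u - g l v) - (g c u - g c v) = of_bool (l = u) - of_bool (l = v)"
proof -
  have nb: "adj E l w = of_bool (w = c)" if "w \<in> V" for w
    using assms that by (auto simp: star_edges_def doubleton_eq_iff)
  have "laplacian_op V E (\<lambda>z. g z u - g z v) l = (g l u - g l v) - (g c u - g c v)"
  proof -
    have "laplacian_op V E (\<lambda>z. g z u - g z v) l
        = (\<Sum>w\<in>V. if w = c then (g l u - g l v) - (g w u - g w v) else 0)"
      unfolding laplacian_op_def by (intro sum.cong refl) (simp add: nb)
    then show ?thesis using finV assms by simp
  qed
  with laplacian_dipole_potential[OF assms(3,4,5)] show ?thesis by simp
qed

lemma star_resistance_leaves:
  assumes "c \<in> V" "E = star_edges V c" "u \<in> V" "v \<in> V" "u \<noteq> v" "u \<noteq> c" "v \<noteq> c"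
  shows "resistance u v = 2"
  using star_leaf_drop[OF assms(1-4), of u] star_leaf_drop[OF assms(1-4), of v] assms
  by (simp add: resistance_def)

lemma trace_star:
  assumes "c \<in> V" "E = star_edges V c"
  shows "2 * real (card V) * ((\<Sum>v\<in>V. g v v) - 1)
    = 2 * (real (card V) - 1 + (real (card V choose 2) - real (card E)) * real (graph_diam V E))"
proof (rule trace_eq_if_nonadjacent_resistance_eq_diam)
  fix u v assume uv: "u \<in> V" "v \<in> V" "u \<noteq> v" "{u, v} \<notin> E"
  then have "u \<noteq> c" "v \<noteq> c" using assms(2) by (auto simp: star_edges_def)
  then have "resistance u v = 2" using star_resistance_leaves assms uv by blast
  moreover have "resistance u v \<le> real (graph_diam V E)"
    using resistance_le_dist[of u v] graph_dist_le_diam[OF finV, of u v E] uv by linarith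
  moreover have "graph_diam V E \<le> 2" using graph_diam_star_le_2[OF finV] assms by blast
  ultimately show "resistance u v = real (graph_diam V E)" by simp
qed

end

section \<open>The Laplacian matrix and its shifted inverse\<close>

lemma sum_nth_distinct:
  assumes "distinct vs"
  shows "(\<Sum>v\<in>set vs. f v) = (\<Sum>i<length vs. f (vs ! i))"
  using sum.reindex_bij_betw[OF bij_betw_nth[OF assms refl refl], of f] by simp

lemma laplacian_carrier: "laplacian vs E \<in> carrier_mat (length vs) (length vs)"
  unfolding laplacian_def degree_matrix_def adjacency_matrix_def
  by (intro minus_carrier_mat mat_carrier)

lemma laplacian_entry:
  assumes "i < length vs" "j < length vs"
  shows "laplacian vs E $$ (i, j)
    = (if i = j then real (degree_of E (vs ! i)) else 0) - adj E (vs ! i) (vs ! j)"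
  using assms by (simp add: laplacian_def degree_matrix_def adjacency_matrix_def)

lemma laplacian_row_apply:
  assumes "simple_graph (set vs) E" "distinct vs" "i < length vs"
  shows "(\<Sum>j<length vs. laplacian vs E $$ (i, j) * x (vs ! j)) = laplacian_op (set vs) E x (vs ! i)"
proof -
  have "(\<Sum>j<length vs. laplacian vs E $$ (i, j) * x (vs ! j))
      = (\<Sum>j<length vs. (if i = j then real (degree_of E (vs ! i)) * x (vs ! i) else 0)
          - adj E (vs ! i) (vs ! j) * x (vs ! j))"
    using assms(3) by (intro sum.cong refl) (simp add: laplacian_entry algebra_simps)
  also have "\<dots> = real (degree_of E (vs ! i)) * x (vs ! i)
      - (\<Sum>v\<in>set vs. adj E (vs ! i) v * x v)"
    using assms(3) by (simp add: sum_subtractf sum_nth_distinct[OF assms(2)])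
  also have "\<dots> = laplacian_op (set vs) E x (vs ! i)"
    unfolding sum_adj[OF assms(1), symmetric] laplacian_op_def
    by (simp add: right_diff_distrib sum_subtractf sum_distrib_right)
  finally show ?thesis .
qed

lemma trace_laplacian:
  assumes G: "simple_graph (set vs) E" and d: "distinct vs"
  shows "trace_mat (laplacian vs E) = 2 * real (card E)"
proof -
  have "{v} \<notin> E" for v using simple_graph_edgeD(3)[OF G, of v v] by auto
  then have "trace_mat (laplacian vs E) = (\<Sum>v\<in>set vs. real (degree_of E v))"
    using laplacian_carrier[of vs E]
    by (simp add: trace_mat_def sum_nth_distinct[OF d] laplacian_entry)
  then show ?thesis
    using sum_degree_of[OF G] by (metis of_nat_mult of_nat_numeral of_nat_sum)
qed

text \<open>The quadratic form of the Laplacian matrix is the Dirichlet energy. It is nonnegative, and on a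
  connected graph it vanishes only for constant potentials, by the bound on potential
  differences. So the trace formula for the shifted inverse applies.\<close>
lemma laplacian_spectral_data:
  assumes G: "simple_graph (set vs) E" and C: "connected_graph (set vs) E" and d: "distinct vs"
  obtains g where "shifted_green (set vs) E g"
    and "2 * rho_ss (laplacian vs E) = (\<Sum>v\<in>set vs. g v v) - 1"
    and "(\<Sum>i = 2..length vs. nth_eigenvalue (laplacian vs E) i) = 2 * real (card E)"
    and "\<And>i. i \<in> {2..length vs} \<Longrightarrow> 0 < nth_eigenvalue (laplacian vs E) i"
proof -
  let ?L = "laplacian vs E" and ?V = "set vs"
  define n where "n = length vs"
  have L: "?L \<in> carrier_mat n n" using laplacian_carrier n_def by simp
  have n: "0 < n" using C by (auto simp: connected_graph_def n_def)
  have cardV: "card ?V = n" using distinct_card[OF d] n_def by simp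
  note rows = laplacian_row_apply[OF G d, folded n_def]
  define ix where "ix = inv_into {..<n} ((!) vs)"
  have ix: "ix (vs ! i) = i" if "i < n" for i
    unfolding ix_def using that d
    by (intro inv_into_f_f) (auto simp: inj_on_def n_def nth_eq_iff_index_eq)
  have ix': "ix v < n" "vs ! ix v = v" if "v \<in> ?V" for v
    using that ix by (auto simp: in_set_conv_nth n_def)
  have apply_eq: "(?L *\<^sub>v x) $ i = laplacian_op ?V E (\<lambda>v. x $ ix v) (vs ! i)"
    if "x \<in> carrier_vec n" "i < n" for x i
  proof -
    have "(?L *\<^sub>v x) $ i = (\<Sum>j<n. ?L $$ (i, j) * x $ ix (vs ! j))"
      using L that by (simp add: scalar_prod_def lessThan_atLeast0 ix)
    then show ?thesis using rows[OF that(2), of "\<lambda>v. x $ ix v"] by simp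
  qed
  have quad: "x \<bullet> (?L *\<^sub>v x) = dirichlet_energy ?V E (\<lambda>v. x $ ix v)" if "x \<in> carrier_vec n" for x
  proof -
    have "x \<bullet> (?L *\<^sub>v x) = (\<Sum>i<n. x $ i * (?L *\<^sub>v x) $ i)"
      using L that by (simp add: scalar_prod_def lessThan_atLeast0 del: index_mult_mat_vec)
    also have "\<dots> = (\<Sum>i<n. x $ ix (vs ! i) * laplacian_op ?V E (\<lambda>v. x $ ix v) (vs ! i))"
      using that by (intro sum.cong refl) (simp add: apply_eq ix del: index_mult_mat_vec)
    finally show ?thesis
      by (simp add: dirichlet_energy_eq sum_nth_distinct[OF d] n_def)
  qed
  have sym: "?L $$ (i, j) = ?L $$ (j, i)" if "i < n" "j < n" for i j
    using that by (simp add: laplacian_entry n_def insert_commute)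
  have psd: "0 \<le> x \<bullet> (?L *\<^sub>v x)" if "x \<in> carrier_vec n" for x
    unfolding quad[OF that] by (rule dirichlet_energy_nonneg)
  have ker: "x $ i = x $ j" if x: "x \<in> carrier_vec n" "?L *\<^sub>v x = 0\<^sub>v n" and ij: "i < n" "j < n" for x i j
  proof -
    have "dirichlet_energy ?V E (\<lambda>v. x $ ix v) = 0"
      using quad[OF x(1)] x by simp
    then have "(x $ ix (vs ! i) - x $ ix (vs ! j))\<^sup>2 \<le> 0"
      using potential_difference_le[OF G C, of "vs ! i" "vs ! j" "\<lambda>v. x $ ix v"] ij
      by (simp add: n_def)
    then show ?thesis using ij by (simp add: ix)
  qed
  have row0: "(\<Sum>j<n. ?L $$ (i, j)) = 0" if "i < n" for i
    using rows[OF that, of "\<lambda>_. 1"] by (simp add: laplacian_op_def)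
  let ?J = "mat (dim_row ?L) (dim_row ?L) (\<lambda>_. 1 / real (dim_row ?L))"
  have dim: "dim_row ?L = n" using L by simp
  obtain M where M: "M \<in> carrier_mat n n" and inv: "(?L + ?J) * M = 1\<^sub>m n"
    and trM: "(\<Sum>i = 2..n. inverse (nth_eigenvalue ?L i)) = trace_mat M - 1"
    and trL: "(\<Sum>i = 2..n. nth_eigenvalue ?L i) = trace_mat ?L"
    and pos: "\<And>i. i \<in> {2..n} \<Longrightarrow> 0 < nth_eigenvalue ?L i"
    using reciprocal_eigenvalue_sum_eq_trace[OF L n sym psd ker row0] by blast
  have entry: "(\<Sum>k<n. ?L $$ (i, k) * M $$ (k, j)) + (\<Sum>k<n. M $$ (k, j)) / real n = of_bool (i = j)"
    if "i < n" "j < n" for i j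
  proof -
    have "((?L + ?J) * M) $$ (i, j) = (\<Sum>k<n. (?L $$ (i, k) + 1 / real n) * M $$ (k, j))"
      using L M that by (simp add: scalar_prod_def lessThan_atLeast0)
    then show ?thesis using inv that
      by (auto simp: distrib_right sum.distrib sum_divide_distrib)
  qed
  \<comment> \<open>Summing the equations of a column of \<open>(L + J) M = 1\<close> over all rows eliminates \<open>L\<close>.\<close>
  have col: "(\<Sum>k<n. M $$ (k, j)) = 1" if j: "j < n" for j
  proof -
    have "(\<Sum>i<n. of_bool (i = j)) = (\<Sum>i<n. \<Sum>k<n. ?L $$ (i, k) * M $$ (k, j))
        + (\<Sum>i<n. (\<Sum>k<n. M $$ (k, j)) / real n)"
      unfolding sum.distrib[symmetric] using entry[OF _ j] by (intro sum.cong refl) simp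
    also have "(\<Sum>i<n. \<Sum>k<n. ?L $$ (i, k) * M $$ (k, j)) = (\<Sum>k<n. (\<Sum>i<n. ?L $$ (k, i)) * M $$ (k, j))"
      by (subst sum.swap) (intro sum.cong refl, simp add: sum_distrib_right sym)
    also have "\<dots> = 0" by (simp add: row0)
    finally show ?thesis using j n by (simp add: of_bool_def)
  qed
  define g where "g u w = M $$ (ix u, ix w)" for u w
  have "shifted_green ?V E g"
  proof
    fix u w assume uw: "u \<in> ?V" "w \<in> ?V"
    have "laplacian_op ?V E (\<lambda>v. g v w) (vs ! ix u) = (\<Sum>k<n. ?L $$ (ix u, k) * g (vs ! k) w)"
      using rows[of "ix u" "\<lambda>v. g v w"] ix' uw by simp
    also have "\<dots> = (\<Sum>k<n. ?L $$ (ix u, k) * M $$ (k, ix w))"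
      by (simp add: g_def ix)
    also have "\<dots> = of_bool (ix u = ix w) - 1 / real n"
      using entry[of "ix u" "ix w"] col[of "ix w"] ix' uw by simp
    also have "ix u = ix w \<longleftrightarrow> u = w" using ix' uw by metis
    finally show "laplacian_op ?V E (\<lambda>v. g v w) u = of_bool (u = w) - 1 / real (card ?V)"
      using ix' uw cardV by simp
  next
    fix w assume "w \<in> ?V"
    then show "(\<Sum>u\<in>?V. g u w) = 1"
      using col[of "ix w"] ix' by (simp add: sum_nth_distinct[OF d] n_def[symmetric] g_def ix)
  qed (fact G C)+
  moreover have "2 * rho_ss ?L = (\<Sum>v\<in>?V. g v v) - 1"
  proof -
    have "(\<Sum>v\<in>?V. g v v) = trace_mat M"
      using M by (simp add: trace_mat_def sum_nth_distinct[OF d] n_def[symmetric] g_def ix)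
    then show ?thesis by (simp add: rho_ss_def dim trM)
  qed
  ultimately show ?thesis
    using trL trace_laplacian[OF G d] pos n_def by (intro that[of g]) auto
qed

section \<open>Bounds on the performance measure\<close>

theorem theorem9:
  fixes V :: "'a set" and E :: "'a set set" and vs :: "'a list" and n m :: nat
  assumes "simple_graph V E"
    and "connected_graph V E"
    and "distinct vs" and "set vs = V"
    and "n = card V" and "n \<ge> 2"
    and "m = card E"
  shows "(real n - 1)\<^sup>2 / (4 * real m) \<le> rho_ss (laplacian vs E)
    \<and> rho_ss (laplacian vs E)
        \<le> 1 / (2 * real n) * (real n - 1 + (real (n choose 2) - real m) * real (graph_diam V E))
    \<and> (E = complete_edges V \<longrightarrow>
        (real n - 1)\<^sup>2 / (4 * real m)
          = 1 / (2 * real n) * (real n - 1 + (real (n choose 2) - real m) * real (graph_diam V E))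
        \<and> rho_ss (laplacian vs E) = (real n - 1) / (2 * real n))
    \<and> ((\<exists>c\<in>V. E = star_edges V c) \<longrightarrow>
        rho_ss (laplacian vs E)
          = 1 / (2 * real n) * (real n - 1 + (real (n choose 2) - real m) * real (graph_diam V E)))"
proof -
  let ?L = "laplacian vs E"
  let ?U = "real n - 1 + (real (n choose 2) - real m) * real (graph_diam V E)"
  have len: "length vs = n" using assms distinct_card by metis
  obtain g where "shifted_green V E g"
    and rho: "2 * rho_ss ?L = (\<Sum>v\<in>V. g v v) - 1"
    and trL: "(\<Sum>i = 2..n. nth_eigenvalue ?L i) = 2 * real m"
    and pos: "\<And>i. i \<in> {2..n} \<Longrightarrow> 0 < nth_eigenvalue ?L i"
    using laplacian_spectral_data[of vs E] assms len by metis
  interpret shifted_green V E g by fact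
  have n: "0 < real n" using assms by simp
  have "0 < (\<Sum>i = 2..n. nth_eigenvalue ?L i)" using pos assms by (intro sum_pos) auto
  then have m: "0 < real m" using trL by simp
  have "(\<Sum>i = 2..n. 1 :: real)\<^sup>2
      \<le> (\<Sum>i = 2..n. nth_eigenvalue ?L i) * (\<Sum>i = 2..n. 1\<^sup>2 / nth_eigenvalue ?L i)"
    using pos by (rule sum_squared_le_weighted_sum)
  also have "(\<Sum>i = 2..n. 1\<^sup>2 / nth_eigenvalue ?L i) = 2 * rho_ss ?L"
    using laplacian_carrier[of vs E] len by (simp add: rho_ss_def inverse_eq_divide)
  finally have "(real n - 1)\<^sup>2 \<le> 4 * real m * rho_ss ?L"
    unfolding trL using assms(6) by (simp add: of_nat_diff algebra_simps)
  then have lower: "(real n - 1)\<^sup>2 / (4 * real m) \<le> rho_ss ?L"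
    using m by (simp add: divide_le_eq mult.commute)
  have upper: "rho_ss ?L \<le> 1 / (2 * real n) * ?U"
    using trace_upper_bound n unfolding rho[symmetric] assms(5,7)[symmetric]
    by (simp add: field_simps)
  have star: "rho_ss ?L = 1 / (2 * real n) * ?U" if "c \<in> V" "E = star_edges V c" for c
    using trace_star[OF that] n unfolding rho[symmetric] assms(5,7)[symmetric]
    by (simp add: field_simps)
  \<comment> \<open>When no pair is nonadjacent, the two bounds coincide and squeeze the performance measure.\<close>
  have complete: "(real n - 1)\<^sup>2 / (4 * real m) = (real n - 1) / (2 * real n)
      \<and> 1 / (2 * real n) * ?U = (real n - 1) / (2 * real n)" if "E = complete_edges V"
  proof -
    have "m = n choose 2"
      unfolding assms(5,7) that complete_edges_def using n_subsets[OF finV] by simp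
    then have "4 * real m = 2 * real n * (real n - 1)"
      using assms(6) by (simp add: choose_two real_of_nat_div of_nat_diff)
    moreover have "real n - 1 \<noteq> 0" using assms(6) by simp
    ultimately have "(real n - 1)\<^sup>2 / (4 * real m) = (real n - 1) / (2 * real n)"
      by (simp only: power2_eq_square) simp
    with \<open>m = n choose 2\<close> show ?thesis by simp
  qed
  show ?thesis using lower upper star complete by force
qed

end
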